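(* Let $k\ge3$ and let $G$ be a $k$-uniform hypergraph with vertex set $[n]$. If $G$ is a sunflower, or a hypercycle, or a squid, or a loose path, then $\alpha(G)=\alpha_j(G)$, where $j\in[n]$ is a vertex of minimum degree.
   Context: A $k$-uniform hypergraph ($k$-graph) $G=(V,E)$ has each edge a $k$-element subset of $V=[n]$; the degree of a vertex $v$ is $|E(v)|$ where $E(v)=\{e\in E: v\in e\}$. The Laplacian tensor $\mathcal{L}$ of $G$ satisfies, for $x\in\mathbb{R}^n$, $\mathcal{L}x^k=\sum_{e\in E}\big(\sum_{i\in e}x[i]^k-k\prod_{i\in e}x[i]\big)$ (it is $\mathcal{D}-\mathcal{A}$ with $\mathcal{D}$ the diagonal degree tensor and $\mathcal{A}$ the adjacency tensor with entries $1/(k-1)!$ on edges). For $j\in[n]$, $\alpha_j(G)=\min\{\mathcal{L}x^k : x\in\mathbb{R}^n_+,\ \sum_{i}x[i]^k=1,\ x[j]=0\}$ and $\alpha(G)=\min_j\alpha_j(G)$. $G$ is a sunflower if $V$ has a disjoint partition $V=V_0\cup V_1\cup\cdots\cup V_d$ with $|V_0|=1$, $|V_1|=\cdots=|V_d|=k-1$ and $E=\{V_0\cup V_i: i\in[d]\}$. $G$ is a hypercycle if there are subsets $V_1,\dots,V_s$ of $V$ with $|V_1|=\cdots=|V_s|=k$, $|V_1\cap V_2|=\cdots=|V_{s-1}\cap V_s|=|V_s\cap V_1|=1$, $V_i\cap V_j=\emptyset$ in all other cases, the intersections $V_1\cap V_2,\dots,V_s\cap V_1$ mutually different, and $E=\{V_i: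 i\in[s]\}$. $G$ is a squid if $V=\{i_{1,1},\dots,i_{1,k},\dots,i_{k-1,1},\dots,i_{k-1,k},i_{k,1}\}$ and $E=\{\{i_{1,1},\dots,i_{1,k}\},\dots,\{i_{k-1,1},\dots,i_{k-1,k}\},\{i_{1,1},\dots,i_{k-1,1},i_{k,1}\}\}$. $G$ is a loose path of length $l$ if $V=\{v_1,\dots,v_{1+l(k-1)}\}$ and $E=\{\{v_{1+i(k-1)},v_{2+i(k-1)},\dots,v_{1+(i+1)(k-1)}\}: 0\le i\le l-1\}$. *)

theory Defs
  imports "HOL-Analysis.Analysis" "HOL-Combinatorics.Multiset_Permutations"
begin

text \<open>
  The vertex set \<open>[n]\<close> is the whole of a finite type \<open>'n\<close>, so that \<open>n = CARD('n)\<close> and vectors of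
  \<open>\<real>\<^sup>n\<close> have type \<open>real ^ 'n\<close>. A hypergraph is given by its edge set \<open>E :: 'n set set\<close>.
\<close>

definition k_uniform :: "nat \<Rightarrow> 'n set set \<Rightarrow> bool" where
  "k_uniform k E \<longleftrightarrow> (\<forall>e\<in>E. card e = k)"

definition degree :: "'n set set \<Rightarrow> 'n \<Rightarrow> nat" where
  "degree E v = card {e \<in> E. v \<in> e}"

definition min_degree_vertex :: "'n set set \<Rightarrow> 'n \<Rightarrow> bool" where
  "min_degree_vertex E j \<longleftrightarrow> (\<forall>i. degree E j \<le> degree E i)"


text \<open>
  A tensor of order \<open>k\<close> and dimension \<open>n\<close> is a function on index lists, used only on lists of
  length \<open>k\<close>; \<open>tensor_form k T x\<close> is the homogeneous form \<open>T x\<^sup>k\<close>.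
\<close>

definition tensor_form :: "nat \<Rightarrow> ('n::finite list \<Rightarrow> real) \<Rightarrow> real ^ 'n \<Rightarrow> real" where
  "tensor_form k T x = (\<Sum>is | length is = k. T is * (\<Prod>i\<leftarrow>is. x $ i))"

definition degree_tensor :: "'n set set \<Rightarrow> 'n list \<Rightarrow> real" where
  "degree_tensor E is = (if set is = {hd is} then real (degree E (hd is)) else 0)"

definition adjacency_tensor :: "nat \<Rightarrow> 'n set set \<Rightarrow> 'n list \<Rightarrow> real" where
  "adjacency_tensor k E is = (if set is \<in> E then 1 / fact (k - 1) else 0)"

definition laplacian_tensor :: "nat \<Rightarrow> 'n set set \<Rightarrow> 'n list \<Rightarrow> real" where
  "laplacian_tensor k E is = degree_tensor E is - adjacency_tensor k E is"

definition feasible :: "nat \<Rightarrow> 'n::finite \<Rightarrow> (real ^ 'n) set" where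
  "feasible k j = {x. (\<forall>i. 0 \<le> x $ i) \<and> (\<Sum>i\<in>UNIV. x $ i ^ k) = 1 \<and> x $ j = 0}"

text \<open>
  The infimum below is a minimum as soon as there are at least two vertices; see
  \<open>alpha_at_attained\<close>.
\<close>

definition alpha_at :: "nat \<Rightarrow> 'n::finite set set \<Rightarrow> 'n \<Rightarrow> real" where
  "alpha_at k E j = (INF x\<in>feasible k j. tensor_form k (laplacian_tensor k E) x)"

definition alpha :: "nat \<Rightarrow> 'n::finite set set \<Rightarrow> real" where
  "alpha k E = Min (range (alpha_at k E))"


definition sunflower :: "nat \<Rightarrow> 'n set set \<Rightarrow> bool" where
  "sunflower k E \<longleftrightarrow>
    (\<exists>(d :: nat) V. 1 \<le> d \<and>
       disjoint_family_on V {0..d} \<and> (\<Union>i\<in>{0..d}. V i) = UNIV \<and>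
       card (V 0) = 1 \<and> (\<forall>i\<in>{1..d}. card (V i) = k - 1) \<and>
       E = {V 0 \<union> V i | i. i \<in> {1..d}})"

text \<open>
  The sets \<open>V\<^sub>1, \<dots>, V\<^sub>s\<close> are indexed here by \<open>0, \<dots>, s - 1\<close>, cyclically. For \<open>k \<ge> 2\<close> the conditions
  force \<open>s \<ge> 3\<close>: for \<open>s = 1\<close> the set \<open>V 0 \<inter> V 0\<close> has \<open>k\<close> elements, and for \<open>s = 2\<close> the two
  consecutive intersections coincide. The edges need not cover all vertices.
\<close>

definition hypercycle :: "nat \<Rightarrow> 'n set set \<Rightarrow> bool" where
  "hypercycle k E \<longleftrightarrow>
    (\<exists>s V. 1 \<le> s \<and>
       (\<forall>i<s. card (V i) = k) \<and>
       (\<forall>i<s. card (V i \<inter> V (Suc i mod s)) = 1) \<and>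
       (\<forall>i<s. \<forall>j<s. i \<noteq> j \<and> j \<noteq> Suc i mod s \<and> i \<noteq> Suc j mod s \<longrightarrow> V i \<inter> V j = {}) \<and>
       inj_on (\<lambda>i. V i \<inter> V (Suc i mod s)) {..<s} \<and>
       E = {V i | i. i < s})"

definition squid :: "nat \<Rightarrow> 'n set set \<Rightarrow> bool" where
  "squid k E \<longleftrightarrow>
    (\<exists>v :: nat \<Rightarrow> nat \<Rightarrow> 'n.
       bij_betw (\<lambda>(p, q). v p q) ({1..k - 1} \<times> {1..k} \<union> {(k, 1)}) UNIV \<and>
       E = {{v p q | q. q \<in> {1..k}} | p. p \<in> {1..k - 1}} \<union> {{v p 1 | p. p \<in> {1..k}}})"

definition loose_path :: "nat \<Rightarrow> nat \<Rightarrow> 'n set set \<Rightarrow> bool" where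
  "loose_path k l E \<longleftrightarrow>
    1 \<le> l \<and>
    (\<exists>v :: nat \<Rightarrow> 'n.
       bij_betw v {1..1 + l * (k - 1)} UNIV \<and>
       E = {v ` {1 + i * (k - 1)..1 + (i + 1) * (k - 1)} | i. i < l})"


lemma sum_degree_tensor:
  fixes x :: "real ^ 'n::finite"
  assumes "1 \<le> k"
  shows "tensor_form k (degree_tensor E) x = (\<Sum>i\<in>UNIV. real (degree E i) * x $ i ^ k)"
proof -
  have fin: "finite {is::'n list. length is = k}"
    using finite_lists_length_eq[of "UNIV :: 'n set" k] by simp
  have inj: "inj_on (replicate k) (UNIV :: 'n set)"
    using assms by (auto simp: inj_on_def replicate_eq_replicate)
  have "tensor_form k (degree_tensor E) x =
      (\<Sum>is\<in>range (replicate k). degree_tensor E is * (\<Prod>i\<leftarrow>is. x $ i))"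
    unfolding tensor_form_def
  proof (rule sum.mono_neutral_right[OF fin])
    show "range (replicate k) \<subseteq> {is::'n list. length is = k}" by auto
    show "\<forall>is\<in>{is::'n list. length is = k} - range (replicate k).
        degree_tensor E is * (\<Prod>i\<leftarrow>is. x $ i) = 0"
    proof
      fix "is" :: "'n list"
      assume A: "is \<in> {is. length is = k} - range (replicate k)"
      have "set is \<noteq> {hd is}"
      proof
        assume "set is = {hd is}"
        then have "is = replicate (length is) (hd is)"
          by (intro replicate_eqI) auto
        with A show False by auto
      qed
      then show "degree_tensor E is * (\<Prod>i\<leftarrow>is. x $ i) = 0"
        by (simp add: degree_tensor_def)
    qed
  qed
  also have "\<dots> = (\<Sum>i\<in>UNIV. real (degree E i) * x $ i ^ k)"
    using assms by (subst sum.reindex[OF inj]) (simp add: degree_tensor_def prod_list_replicate)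
  finally show ?thesis .
qed

lemma sum_adjacency_tensor:
  fixes x :: "real ^ 'n::finite"
  assumes k: "1 \<le> k" and E: "k_uniform k E"
  shows "tensor_form k (adjacency_tensor k E) x = (\<Sum>e\<in>E. real k * (\<Prod>i\<in>e. x $ i))"
proof -
  let ?t = "\<lambda>is. adjacency_tensor k E is * (\<Prod>i\<leftarrow>is. x $ i)"
  have fin: "finite {is::'n list. length is = k}"
    using finite_lists_length_eq[of "UNIV :: 'n set" k] by simp
  have len: "length is = k \<and> distinct is"
    if "e \<in> E" "is \<in> permutations_of_set e" for e "is"
    using that E by (auto simp: permutations_of_set_def k_uniform_def distinct_card)
  have "tensor_form k (adjacency_tensor k E) x = (\<Sum>is\<in>(\<Union>e\<in>E. permutations_of_set e). ?t is)"
    unfolding tensor_form_def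
  proof (rule sum.mono_neutral_right[OF fin])
    show "(\<Union>e\<in>E. permutations_of_set e) \<subseteq> {is. length is = k}"
      using len by blast
    show "\<forall>is\<in>{is. length is = k} - (\<Union>e\<in>E. permutations_of_set e). ?t is = 0"
      using E by (auto simp: adjacency_tensor_def k_uniform_def permutations_of_set_def
          intro: card_distinct)
  qed
  also have "\<dots> = (\<Sum>e\<in>E. \<Sum>is\<in>permutations_of_set e. ?t is)"
    by (rule sum.UNION_disjoint) (simp_all, auto simp: permutations_of_set_def)
  also have "\<dots> = (\<Sum>e\<in>E. real k * (\<Prod>i\<in>e. x $ i))"
  proof (rule sum.cong[OF refl])
    fix e assume e: "e \<in> E"
    have "?t is = 1 / fact (k - 1) * (\<Prod>i\<in>e. x $ i)" if "is \<in> permutations_of_set e" for "is"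
      using that e by (auto simp: adjacency_tensor_def permutations_of_set_def
          prod.distinct_set_conv_list)
    then have "(\<Sum>is\<in>permutations_of_set e. ?t is) =
        fact k * (1 / fact (k - 1) * (\<Prod>i\<in>e. x $ i))"
      using e E by (simp add: k_uniform_def)
    also have "\<dots> = real k * (\<Prod>i\<in>e. x $ i)"
      using k by (simp add: fact_reduce[of k])
    finally show "(\<Sum>is\<in>permutations_of_set e. ?t is) = real k * (\<Prod>i\<in>e. x $ i)" .
  qed
  finally show ?thesis .
qed

lemma laplacian_form:
  fixes x :: "real ^ 'n::finite"
  assumes "1 \<le> k" and "k_uniform k E"
  shows "tensor_form k (laplacian_tensor k E) x =
    (\<Sum>e\<in>E. (\<Sum>i\<in>e. x $ i ^ k) - real k * (\<Prod>i\<in>e. x $ i))"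
proof -
  have "(\<Sum>i\<in>UNIV. real (degree E i) * x $ i ^ k) =
      (\<Sum>i\<in>UNIV. \<Sum>e\<in>E. if i \<in> e then x $ i ^ k else 0)"
    by (intro sum.cong refl) (simp add: degree_def flip: sum.inter_filter)
  also have "\<dots> = (\<Sum>e\<in>E. \<Sum>i\<in>e. x $ i ^ k)"
    by (subst sum.swap) (simp add: sum.If_cases)
  moreover have "tensor_form k (laplacian_tensor k E) x =
      tensor_form k (degree_tensor E) x - tensor_form k (adjacency_tensor k E) x"
    by (simp add: tensor_form_def laplacian_tensor_def left_diff_distrib sum_subtractf)
  ultimately show ?thesis
    using assms by (simp add: sum_degree_tensor sum_adjacency_tensor sum_subtractf)
qed

lemma alpha_at_attained:
  fixes j :: "'n::finite"
  assumes "1 \<le> k" and "2 \<le> CARD('n)"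
  shows "\<exists>x\<in>feasible k j. alpha_at k E j = tensor_form k (laplacian_tensor k E) x \<and>
    (\<forall>y\<in>feasible k j. alpha_at k E j \<le> tensor_form k (laplacian_tensor k E) y)"
proof -
  let ?f = "tensor_form k (laplacian_tensor k E)"
  have "x $ i \<le> 1" if "x \<in> feasible k j" for x :: "real ^ 'n" and i
  proof (rule ccontr)
    assume "\<not> x $ i \<le> 1"
    then have "1 < x $ i ^ k"
      using assms(1) by (intro one_less_power) auto
    also have "\<dots> \<le> (\<Sum>i\<in>UNIV. x $ i ^ k)"
      using that by (intro member_le_sum) (auto simp: feasible_def)
    finally show False
      using that by (simp add: feasible_def)
  qed
  then have "feasible k j \<subseteq> cbox 0 1"
    by (auto simp: mem_box_cart feasible_def)
  then have "bounded (feasible k j)"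
    using bounded_cbox bounded_subset by blast
  moreover have "closed (feasible k j)"
    unfolding feasible_def
    by (intro closed_Collect_conj closed_Collect_all closed_Collect_le closed_Collect_eq
        continuous_intros)
  ultimately have comp: "compact (feasible k j)"
    by (simp add: compact_eq_bounded_closed)
  obtain i where "i \<noteq> j"
    using assms(2) by (metis (full_types) UNIV_eq_I card_1_singleton_iff insertI1 singletonI
        One_nat_def Suc_1 not_less_eq_eq order_refl)
  then have "axis i 1 \<in> feasible k j"
    using assms(1) by (simp add: feasible_def axis_def if_distrib[of "\<lambda>a. a ^ k"] power_0_left
        cong: if_cong)
  then have ne: "feasible k j \<noteq> {}" by blast
  have prod_cont: "continuous_on S (\<lambda>x. \<Prod>i\<leftarrow>is. x $ i)"
    for S :: "(real ^ 'n) set" and "is" :: "'n list"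
    by (induction "is") (auto intro!: continuous_intros)
  have cont: "continuous_on (feasible k j) ?f"
    unfolding tensor_form_def by (intro continuous_intros prod_cont)
  obtain x where x: "x \<in> feasible k j" "\<And>y. y \<in> feasible k j \<Longrightarrow> ?f x \<le> ?f y"
    using continuous_attains_inf[OF comp ne cont] by blast
  then have "alpha_at k E j = ?f x"
    unfolding alpha_at_def by (intro cInf_eq_minimum) auto
  with x show ?thesis by auto
qed

end

theory Submission
  imports Defs
begin

text \<open>
  Let \<open>j\<close> be a vertex such that every edge through \<open>j\<close> also contains \<open>i\<close>. On vectors with
  \<open>x[i] = 0\<close> the form is \<open>\<L>x\<^sup>k = \<L>y\<^sup>k + deg(j) x[j]\<^sup>k\<close>, where \<open>y\<close> is \<open>x\<close> with its \<open>j\<close>-th entry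
  set to zero. Hence \<open>\<alpha>\<^sub>j \<le> deg(j)\<close> implies \<open>\<alpha>\<^sub>j \<le> \<alpha>\<^sub>i\<close> by homogeneity. The bound \<open>\<alpha>\<^sub>j \<le> deg(j)\<close> is
  witnessed by a unit vector at another vertex of the same degree, or by the all-ones vector off \<open>j\<close>
  if \<open>j\<close> is isolated. In each of the four families every edge has a vertex of degree one, which
  serves as \<open>j\<close> for all other vertices \<open>i\<close> of that edge.
\<close>

section \<open>Upper bounds on \<open>alpha_at\<close> from test vectors\<close>

text \<open>The form is homogeneous of degree \<open>k\<close>, so a nonzero \<open>y\<close> can be
  rescaled into \<open>feasible k j\<close>; this spares later test vectors any
  normalisation.\<close>

lemma alpha_at_le_form:
  fixes y :: "real ^ 'n::finite"
  assumes k: "1 \<le> k" and n: "2 \<le> CARD('n)" and E: "k_uniform k E"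
    and nonneg: "\<And>i. 0 \<le> y $ i" and j: "y $ j = 0"
  shows "alpha_at k E j * (\<Sum>i\<in>UNIV. y $ i ^ k) \<le> tensor_form k (laplacian_tensor k E) y"
proof (cases "(\<Sum>i\<in>UNIV. y $ i ^ k) = 0")
  case True
  then have "y $ i ^ k = 0" for i
    using nonneg by (subst (asm) sum_nonneg_eq_0_iff) auto
  then have "y = 0"
    by (simp add: vec_eq_iff)
  \<comment> \<open>Edges are nonempty because \<open>k\<close> is positive, so the products vanish
    along with the powers.\<close>
  then show ?thesis
    using k E by (auto simp: laplacian_form zero_power prod_zero_iff k_uniform_def power_0_left)
next
  case False
  define M where "M = (\<Sum>i\<in>UNIV. y $ i ^ k)"
  define c where "c = inverse (root k M)"
  define z where "z = c *\<^sub>R y"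
  have M: "0 < M"
    using False nonneg by (simp add: M_def sum_nonneg order_less_le)
  have c: "0 \<le> c" "c ^ k = inverse M"
    using M k by (simp_all add: c_def power_inverse real_root_pow_pos)
  have "z \<in> feasible k j"
    using c M nonneg j
    by (simp add: feasible_def z_def power_mult_distrib flip: sum_distrib_left) (simp add: M_def)
  then have "alpha_at k E j \<le> tensor_form k (laplacian_tensor k E) z"
    using alpha_at_attained[OF k n] by blast
  also have "\<dots> = c ^ k * tensor_form k (laplacian_tensor k E) y"
    unfolding laplacian_form[OF k E] sum_distrib_left
  \<comment> \<open>An edge has exactly \<open>k\<close> vertices, so its product picks up the same
    factor \<open>c ^ k\<close> as the powers.\<close>
  proof (rule sum.cong[OF refl])
    fix e assume "e \<in> E"
    then have "card e = k"
      using E by (simp add: k_uniform_def)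
    then show "(\<Sum>i\<in>e. z $ i ^ k) - real k * (\<Prod>i\<in>e. z $ i) =
        c ^ k * ((\<Sum>i\<in>e. y $ i ^ k) - real k * (\<Prod>i\<in>e. y $ i))"
      by (simp add: z_def power_mult_distrib prod.distrib right_diff_distrib flip: sum_distrib_left)
  qed
  finally show ?thesis
    using M c by (simp add: field_simps flip: M_def)
qed

lemma alpha_at_le_degree_other:
  fixes l :: "'n::finite"
  assumes k: "2 \<le> k" and E: "k_uniform k E" and l: "l \<noteq> j"
  shows "alpha_at k E j \<le> degree E l"
proof -
  let ?y = "axis l 1 :: real ^ 'n"
  have k1: "1 \<le> k"
    using k by simp
  have n: "2 \<le> CARD('n)"
    using card_mono[of UNIV "{l, j}"] l by simp
  have pow: "?y $ i ^ k = (if i = l then 1 else 0)" for i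
    using k by (simp add: axis_def)
  have prod: "(\<Prod>i\<in>e. ?y $ i) = 0" if "e \<in> E" for e
  proof -
    \<comment> \<open>With \<open>k\<close> at least 2 an edge contains a vertex other than
      \<open>l\<close>, where \<open>?y\<close> is zero.\<close>
    have "\<not> e \<subseteq> {l}"
      using that E k card_mono[of "{l}" e] by (auto simp: k_uniform_def)
    then obtain i where "i \<in> e" "i \<noteq> l"
      by blast
    then show ?thesis
      by (auto simp: axis_def)
  qed
  have "tensor_form k (laplacian_tensor k E) ?y = (\<Sum>e\<in>E. if l \<in> e then 1 else 0)"
    by (simp add: laplacian_form[OF k1 E] pow prod)
  also have "\<dots> = degree E l"
    by (simp add: degree_def flip: sum.inter_filter)
  finally show ?thesis
    using alpha_at_le_form[OF k1 n E, of ?y j] l by (simp add: pow) (simp add: axis_def)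
qed

text \<open>The all-ones vector off \<open>j\<close> is constantly 1 on every edge, so each edge
  contributes \<open>k - k\<close>.\<close>

lemma alpha_at_isolated_nonpos:
  fixes j :: "'n::finite"
  assumes k: "1 \<le> k" and n: "2 \<le> CARD('n)" and E: "k_uniform k E" and j: "degree E j = 0"
  shows "alpha_at k E j \<le> 0"
proof -
  let ?y = "(\<chi> i. if i = j then 0 else 1) :: real ^ 'n"
  have ne: "i \<noteq> j" if "e \<in> E" "i \<in> e" for e i
    using that j by (auto simp: degree_def)
  have "tensor_form k (laplacian_tensor k E) ?y = (\<Sum>e\<in>E. (\<Sum>i\<in>e. 1) - real k * (\<Prod>i\<in>e. 1))"
    unfolding laplacian_form[OF k E] using ne by (intro sum.cong arg_cong2[where f = minus]
        arg_cong2[where f = times] prod.cong) auto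
  also have "\<dots> = 0"
    using E by (simp add: k_uniform_def)
  finally have "alpha_at k E j * (\<Sum>i\<in>UNIV. ?y $ i ^ k) \<le> 0"
    using alpha_at_le_form[OF k n E, of ?y j] by simp
  moreover have "(\<Sum>i\<in>UNIV. ?y $ i ^ k) = real (card (UNIV - {j}))"
    using k by (simp add: if_distrib[of "\<lambda>a. a ^ k"] sum.If_cases power_0_left Compl_eq_Diff_UNIV
        cong: if_cong)
  ultimately show ?thesis
    using n by (simp add: mult_le_0_iff)
qed

text \<open>The bound \<open>le\<close> stays a hypothesis because it has two sources: nonpositivity
  when \<open>j\<close> is isolated, and a second vertex of degree one when \<open>j\<close> has
  degree one.\<close>

lemma alpha_at_le_alpha_at:
  fixes i j :: "'n::finite"
  assumes k: "1 \<le> k" and E: "k_uniform k E" and ij: "i \<noteq> j"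
    and dom: "\<And>e. e \<in> E \<Longrightarrow> j \<in> e \<Longrightarrow> i \<in> e" and le: "alpha_at k E j \<le> degree E j"
  shows "alpha_at k E j \<le> alpha_at k E i"
proof -
  let ?Q = "tensor_form k (laplacian_tensor k E)"
  have n: "2 \<le> CARD('n)"
    using card_mono[of UNIV "{i, j}"] ij by simp
  obtain x where x: "x \<in> feasible k i" and Qx: "alpha_at k E i = ?Q x"
    using alpha_at_attained[OF k n] by blast
  define y :: "real ^ 'n" where "y = (\<chi> l. if l = j then 0 else x $ l)"
  define t where "t = x $ j ^ k"
  have t: "0 \<le> t"
    using x by (simp add: t_def feasible_def)
  have split: "x $ l ^ k = y $ l ^ k + (if l = j then t else 0)" for l
    using k by (simp add: y_def t_def)
  have "(\<Sum>l\<in>UNIV. y $ l ^ k) + t = 1"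
    using x by (simp add: feasible_def split sum.distrib)
  then have M: "(\<Sum>l\<in>UNIV. y $ l ^ k) = 1 - t"
    by simp
  have edge: "(\<Sum>l\<in>e. x $ l ^ k) - real k * (\<Prod>l\<in>e. x $ l) =
      (\<Sum>l\<in>e. y $ l ^ k) - real k * (\<Prod>l\<in>e. y $ l) + (if j \<in> e then t else 0)"
    if "e \<in> E" for e
  proof -
    \<comment> \<open>If \<open>j\<close> is in \<open>e\<close>, both products are zero: the left
      one through \<open>i\<close>, the right one through \<open>j\<close>.\<close>
    have "(\<Prod>l\<in>e. x $ l) = (\<Prod>l\<in>e. y $ l)"
    proof (cases "j \<in> e")
      case True
      then have "i \<in> e" "x $ i = 0" "y $ j = 0"
        using dom that x by (auto simp: y_def feasible_def)
      with True show ?thesis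
        by (metis finite prod_zero)
    next
      case False
      then show ?thesis
        by (intro prod.cong) (auto simp: y_def)
    qed
    then show ?thesis
      by (simp add: split sum.distrib)
  qed
  have "?Q x = ?Q y + (\<Sum>e\<in>E. if j \<in> e then t else 0)"
    by (simp add: laplacian_form[OF k E] edge sum.distrib cong: sum.cong)
  also have "(\<Sum>e\<in>E. if j \<in> e then t else 0) = degree E j * t"
    by (simp add: degree_def flip: sum.inter_filter)
  finally have Q: "?Q x = ?Q y + degree E j * t" .
  \<comment> \<open>The unit mass of \<open>x\<close> splits into \<open>1 - t\<close>, carried by
    \<open>y\<close>, and \<open>t\<close>, sitting at \<open>j\<close>; the first part is bounded
    by homogeneity, the second by \<open>le\<close>.\<close>
  have "alpha_at k E j = alpha_at k E j * (1 - t) + alpha_at k E j * t"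
    by (simp add: algebra_simps)
  also have "\<dots> \<le> ?Q y + degree E j * t"
  proof (intro add_mono mult_right_mono le t)
    show "alpha_at k E j * (1 - t) \<le> ?Q y"
      using alpha_at_le_form[OF k n E, of y j] x unfolding M by (simp add: y_def feasible_def)
  qed
  finally show ?thesis
    using Q Qx by simp
qed

section \<open>Hypergraphs in which every edge has a vertex of degree one\<close>

lemma degree_eq_1_iff:
  fixes E :: "'n set set"
  shows "degree E v = 1 \<longleftrightarrow> (\<exists>e\<in>E. v \<in> e \<and> (\<forall>f\<in>E. v \<in> f \<longrightarrow> f = e))"
proof -
  have "{e \<in> E. v \<in> e} = {e} \<longleftrightarrow> e \<in> E \<and> v \<in> e \<and> (\<forall>f\<in>E. v \<in> f \<longrightarrow> f = e)" for e
    by blast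
  then show ?thesis
    unfolding degree_def One_nat_def card_1_singleton_iff Bex_def by simp
qed

text \<open>Condition \<open>two\<close> supplies, for any \<open>j\<close> of degree one, another
  such vertex whose unit vector bounds \<open>alpha_at k E j\<close>. Isolated vertices, which a
  hypercycle may have, form a separate case.\<close>

lemma alpha_eq_alpha_at_min_degree:
  fixes E :: "'n::finite set set"
  assumes k: "2 \<le> k" and E: "k_uniform k E"
    and leaf: "\<forall>e\<in>E. \<exists>v\<in>e. degree E v = 1"
    and two: "\<exists>a b. a \<noteq> b \<and> degree E a = 1 \<and> degree E b = 1"
  shows "\<exists>j. min_degree_vertex E j \<and> alpha k E = alpha_at k E j"
proof -
  have k1: "1 \<le> k"
    using k by simp
  obtain a b where ab: "a \<noteq> b" "degree E a = 1" "degree E b = 1"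
    using two by blast
  have n: "2 \<le> CARD('n)"
    using card_mono[of UNIV "{a, b}"] ab by simp
  have below: "\<exists>j. min_degree_vertex E j \<and> alpha_at k E j \<le> alpha_at k E i" for i
  proof (cases "\<exists>j. degree E j = 0")
    case True
    then obtain j where j: "degree E j = 0"
      by blast
    \<comment> \<open>No edge contains \<open>j\<close>, so the domination condition holds
      vacuously.\<close>
    then have "alpha_at k E j \<le> alpha_at k E i"
      using alpha_at_le_alpha_at[OF k1 E, of i j] alpha_at_isolated_nonpos[OF k1 n E j]
      by (cases "i = j") (auto simp: degree_def)
    with j show ?thesis
      by (intro exI[of _ j]) (simp add: min_degree_vertex_def)
  next
    case False
    then have min: "min_degree_vertex E j" if "degree E j = 1" for j
      unfolding min_degree_vertex_def that by (simp add: Suc_le_eq)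
    from False have "card {e \<in> E. i \<in> e} \<noteq> 0"
      by (simp add: degree_def)
    then have "{e \<in> E. i \<in> e} \<noteq> {}"
      by force
    then obtain e where e: "e \<in> E" "i \<in> e"
      by blast
    then obtain j where j: "j \<in> e" "degree E j = 1"
      using leaf by blast
    define l where "l = (if a = j then b else a)"
    then have l: "l \<noteq> j" "degree E l = 1"
      using ab by auto
    have "alpha_at k E j \<le> alpha_at k E i"
    proof (cases "i = j")
      case False
      show ?thesis
      proof (rule alpha_at_le_alpha_at[OF k1 E False])
        \<comment> \<open>As \<open>j\<close> has degree one, \<open>f\<close> must be
          \<open>e\<close>.\<close>
        show "i \<in> f" if "f \<in> E" "j \<in> f" for f
          using that e j unfolding degree_eq_1_iff by blast
        show "alpha_at k E j \<le> degree E j"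
          using alpha_at_le_degree_other[OF k E l(1)] l j by simp
      qed
    qed simp
    with min j show ?thesis
      by blast
  qed
  have "alpha k E \<in> range (alpha_at k E)"
    unfolding alpha_def by (rule Min_in) simp_all
  then obtain i where "alpha k E = alpha_at k E i" ..
  with below[of i] obtain j where j: "min_degree_vertex E j" "alpha_at k E j \<le> alpha k E"
    by auto
  have "alpha k E \<le> alpha_at k E j"
    by (simp add: alpha_def)
  with j show ?thesis
    using order_antisym by blast
qed

section \<open>Vertices of degree one in the four families\<close>

text \<open>All petal vertices have degree one, and a petal has \<open>k - 1\<close>, hence at least
  two, of them; so a single petal already suffices.\<close>

lemma sunflower_degree_1:
  fixes E :: "'n::finite set set"
  assumes k: "3 \<le> k" and S: "sunflower k E"
  shows "\<forall>e\<in>E. \<exists>v\<in>e. degree E v = 1" and "\<exists>a b. a \<noteq> b \<and> degree E a = 1 \<and> degree E b = 1"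
proof -
  obtain d :: nat and V where d: "1 \<le> d" and disj: "disjoint_family_on V {0..d}"
    and card: "\<forall>i\<in>{1..d}. card (V i) = k - 1" and E: "E = {V 0 \<union> V i | i. i \<in> {1..d}}"
    using S unfolding sunflower_def by (elim exE conjE) (rule that)
  have deg: "degree E v = 1" if i: "i \<in> {1..d}" and v: "v \<in> V i" for v i
  proof -
    have "V 0 \<union> V i' = V 0 \<union> V i" if "i' \<in> {1..d}" "v \<in> V 0 \<union> V i'" for i'
    proof -
      have "v \<notin> V 0" "i' \<noteq> i \<Longrightarrow> v \<notin> V i'"
        using disj i v that(1) by (auto simp: disjoint_family_on_def disjoint_iff)
      with that show ?thesis
        by auto
    qed
    with i v show ?thesis
      unfolding degree_eq_1_iff E by blast
  qed
  have pair: "\<exists>a\<in>V i. \<exists>b\<in>V i. a \<noteq> b" if "i \<in> {1..d}" for i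
    using that card k card_le_Suc0_iff_eq[of "V i"] by fastforce
  show "\<forall>e\<in>E. \<exists>v\<in>e. degree E v = 1"
    using deg pair unfolding E by blast
  show "\<exists>a b. a \<noteq> b \<and> degree E a = 1 \<and> degree E b = 1"
    using deg[of 1] pair[of 1] d by auto
qed

text \<open>An edge shares at most two of its \<open>k\<close> vertices with its cyclic neighbours
  and none with other edges, so with \<open>k\<close> at least 3 some vertex is private to
  it.\<close>

lemma hypercycle_degree_1:
  fixes E :: "'n::finite set set"
  assumes k: "3 \<le> k" and H: "hypercycle k E"
  shows "\<forall>e\<in>E. \<exists>v\<in>e. degree E v = 1" and "\<exists>a b. a \<noteq> b \<and> degree E a = 1 \<and> degree E b = 1"
proof -
  obtain s V where s: "1 \<le> s" and card: "\<forall>i<s. card (V i) = k"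
    and inter: "\<forall>i<s. card (V i \<inter> V (Suc i mod s)) = 1"
    and disj: "\<forall>i<s. \<forall>j<s. i \<noteq> j \<and> j \<noteq> Suc i mod s \<and> i \<noteq> Suc j mod s \<longrightarrow> V i \<inter> V j = {}"
    and E: "E = {V i | i. i < s}"
    using H unfolding hypercycle_def by (elim exE conjE) (rule that)
  have leaf: "\<exists>v\<in>V i. degree E v = 1" if i: "i < s" for i
  proof -
    \<comment> \<open>The cyclic predecessor of \<open>i\<close>.\<close>
    define p where "p = (if i = 0 then s - 1 else i - 1)"
    have p: "p < s" "Suc p mod s = i"
      using i s by (auto simp: p_def)
    have p_unique: "j = p" if "j < s" "i = Suc j mod s" for j
      using that by (auto simp: p_def mod_Suc split: if_splits)
    let ?I = "(V i \<inter> V (Suc i mod s)) \<union> (V p \<inter> V i)"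
    have "card ?I \<le> 2"
      using card_Un_le[of "V i \<inter> V (Suc i mod s)" "V p \<inter> V i"] inter i p by force
    then have "card ?I < card (V i)"
      using card i k by simp
    then have "\<not> V i \<subseteq> ?I"
      using card_mono[of ?I "V i"] by fastforce
    then obtain v where v: "v \<in> V i" "v \<notin> V (Suc i mod s)" "v \<notin> V p"
      by blast
    have "j = i" if j: "j < s" "v \<in> V j" for j
    proof (rule ccontr)
      assume "j \<noteq> i"
      with j v i disj show False
        by (metis disjoint_iff p_unique)
    qed
    with v i have "degree E v = 1"
      unfolding degree_eq_1_iff E by blast
    with v show ?thesis
      by blast
  qed
  then show "\<forall>e\<in>E. \<exists>v\<in>e. degree E v = 1"
    by (auto simp: E)
  \<comment> \<open>For \<open>s = 1\<close> the intersection of \<open>V 0\<close> with its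
    successor would be \<open>V 0\<close> itself, of size \<open>k\<close>.\<close>
  have "s \<noteq> 1"
    using card inter k by force
  then have s2: "1 < s"
    using s by simp
  then have "V 0 \<noteq> V 1"
    using card[rule_format, of 0] inter[rule_format, of 0] k by auto
  moreover obtain a b where "a \<in> V 0" "degree E a = 1" "b \<in> V 1" "degree E b = 1"
    using leaf s2 by (meson less_trans zero_less_one)
  moreover have "V 0 \<in> E" "V 1 \<in> E"
    using s2 s by (auto simp: E Suc_le_eq)
  \<comment> \<open>A common vertex of degree one would force \<open>V 0 = V 1\<close>.\<close>
  ultimately have "a \<noteq> b"
    unfolding degree_eq_1_iff by blast
  with \<open>degree E a = 1\<close> \<open>degree E b = 1\<close> show "\<exists>a b. a \<noteq> b \<and> degree E a = 1 \<and> degree E b = 1"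
    by blast
qed

text \<open>The vertices \<open>v p q\<close> with \<open>q\<close> at least 2 are private to the
  \<open>p\<close>-th arm, and \<open>v k 1\<close> is private to the edge joining the arms.\<close>

lemma squid_degree_1:
  fixes E :: "'n set set"
  assumes k: "3 \<le> k" and S: "squid k E"
  shows "\<forall>e\<in>E. \<exists>v\<in>e. degree E v = 1" and "\<exists>a b. a \<noteq> b \<and> degree E a = 1 \<and> degree E b = 1"
proof -
  obtain v :: "nat \<Rightarrow> nat \<Rightarrow> 'n" where
    bij: "bij_betw (\<lambda>(p, q). v p q) ({1..k - 1} \<times> {1..k} \<union> {(k, 1)}) UNIV"
    and E: "E = {{v p q | q. q \<in> {1..k}} | p. p \<in> {1..k - 1}} \<union> {{v p 1 | p. p \<in> {1..k}}}"
    using S unfolding squid_def by (elim exE conjE) (rule that)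
  let ?I = "{1..k - 1} \<times> {1..k} \<union> {(k, 1)}"
  have inj: "p = p' \<and> q = q'" if "v p q = v p' q'" "(p, q) \<in> ?I" "(p', q') \<in> ?I" for p q p' q'
    using inj_onD[OF bij_betw_imp_inj_on[OF bij], of "(p, q)" "(p', q')"] that by simp
  have tip: "degree E (v p q) = 1" if p: "p \<in> {1..k - 1}" and q: "q \<in> {2..k}" for p q
  proof -
    have "e = {v p q | q. q \<in> {1..k}}" if "e \<in> E" "v p q \<in> e" for e
      using that(1) unfolding E
    proof (elim UnE)
      assume "e \<in> {{v p q | q. q \<in> {1..k}} | p. p \<in> {1..k - 1}}"
      then obtain p' where p': "p' \<in> {1..k - 1}" "e = {v p' q | q. q \<in> {1..k}}"
        by blast
      with that(2) obtain q' where "q' \<in> {1..k}" "v p q = v p' q'"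
        by blast
      with p q p' inj[of p q p' q'] show ?thesis
        by auto
    next
      assume "e \<in> {{v p 1 | p. p \<in> {1..k}}}"
      with that(2) obtain p' where "p' \<in> {1..k}" "v p q = v p' 1"
        by blast
      \<comment> \<open>The index \<open>(k, 1)\<close> lies outside the product and is the extra
        element of \<open>?I\<close>.\<close>
      moreover from this have "(p', 1) \<in> ?I"
        by (cases "p' = k") auto
      ultimately show ?thesis
        using p q inj[of p q p' 1] by auto
    qed
    moreover have "{v p q | q. q \<in> {1..k}} \<in> E"
      using p by (auto simp: E)
    moreover have "v p q \<in> {v p q | q. q \<in> {1..k}}"
      using q by auto
    ultimately show ?thesis
      unfolding degree_eq_1_iff by blast
  qed
  have apex: "degree E (v k 1) = 1"
  proof -
    have "e = {v p 1 | p. p \<in> {1..k}}" if "e \<in> E" "v k 1 \<in> e" for e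
      using that(1) unfolding E
    proof (elim UnE)
      assume "e \<in> {{v p q | q. q \<in> {1..k}} | p. p \<in> {1..k - 1}}"
      with that(2) obtain p q where "p \<in> {1..k - 1}" "q \<in> {1..k}" "v k 1 = v p q"
        by blast
      with inj[of k 1 p q] show ?thesis
        by auto
    qed simp
    moreover have "v k 1 \<in> {v p 1 | p. p \<in> {1..k}}"
      using k by auto
    moreover have "{v p 1 | p. p \<in> {1..k}} \<in> E"
      unfolding E by simp
    ultimately show ?thesis
      unfolding degree_eq_1_iff by blast
  qed
  show "\<forall>e\<in>E. \<exists>v\<in>e. degree E v = 1"
  proof
    fix e assume "e \<in> E"
    then consider p where "p \<in> {1..k - 1}" "e = {v p q | q. q \<in> {1..k}}"
      | "e = {v p 1 | p. p \<in> {1..k}}"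
      unfolding E by blast
    then show "\<exists>v\<in>e. degree E v = 1"
    proof cases
      case 1
      then have "v p 2 \<in> e" "degree E (v p 2) = 1"
        using k tip[of p 2] by auto
      then show ?thesis ..
    next
      case 2
      then have "v k 1 \<in> e"
        using k by auto
      with apex show ?thesis ..
    qed
  qed
  have "degree E (v 1 2) = 1"
    using k by (intro tip) auto
  moreover have "v 1 2 \<noteq> v k 1"
  proof
    assume "v 1 2 = v k 1"
    then have "1 = k \<and> (2::nat) = 1"
      using k by (intro inj) auto
    then show False
      by simp
  qed
  ultimately show "\<exists>a b. a \<noteq> b \<and> degree E a = 1 \<and> degree E b = 1"
    using apex by blast
qed

text \<open>Consecutive edges meet only in an end vertex, so the second vertex of each edge is
  private to it. The start of the path is another vertex of degree one, which also covers a path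
  with one edge.\<close>

lemma loose_path_degree_1:
  fixes E :: "'n set set"
  assumes k: "3 \<le> k" and L: "loose_path k l E"
  shows "\<forall>e\<in>E. \<exists>v\<in>e. degree E v = 1" and "\<exists>a b. a \<noteq> b \<and> degree E a = 1 \<and> degree E b = 1"
proof -
  define J where "J i = {1 + i * (k - 1)..1 + (i + 1) * (k - 1)}" for i
  obtain v :: "nat \<Rightarrow> 'n" where l: "1 \<le> l" and bij: "bij_betw v {1..1 + l * (k - 1)} UNIV"
    and E: "E = {v ` J i | i. i < l}"
    using L unfolding loose_path_def by (elim exE conjE) (rule that[unfolded J_def])
  have sub: "J i \<subseteq> {1..1 + l * (k - 1)}" if "i < l" for i
    using mult_le_mono1[of "i + 1" l "k - 1"] that by (auto simp: J_def)
  have deg: "degree E (v m) = 1"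
    if i: "i < l" and m: "m \<in> J i" and uniq: "\<And>i'. m \<in> J i' \<Longrightarrow> i' = i" for m i
  proof -
    have "i' = i" if "i' < l" "v m \<in> v ` J i'" for i'
    proof -
      have "m \<in> J i'"
        using inj_on_image_mem_iff[OF bij_betw_imp_inj_on[OF bij] _ sub[OF that(1)]]
          sub[OF i] m that(2) by blast
      then show ?thesis
        by (rule uniq)
    qed
    with i m show ?thesis
      unfolding degree_eq_1_iff E by blast
  qed
  have second: "degree E (v (2 + i * (k - 1))) = 1" "2 + i * (k - 1) \<in> J i" if "i < l" for i
  proof -
    show mem: "2 + i * (k - 1) \<in> J i"
      using k by (simp add: J_def)
    show "degree E (v (2 + i * (k - 1))) = 1"
    proof (rule deg[OF that mem])
      fix i' assume "2 + i * (k - 1) \<in> J i'"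
      \<comment> \<open>The first inequality is strict because \<open>k - 1\<close> exceeds 1;
        cancelling \<open>k - 1\<close> leaves only \<open>i' = i\<close>.\<close>
      then have "i' * (k - 1) < (i + 1) * (k - 1)" "i * (k - 1) < (i' + 1) * (k - 1)"
        using k by (auto simp: J_def)
      then show "i' = i"
        unfolding mult_less_cancel2 by simp
    qed
  qed
  then show "\<forall>e\<in>E. \<exists>v\<in>e. degree E v = 1"
    unfolding E by blast
  have "degree E (v 1) = 1"
    using l k by (intro deg[of 0]) (auto simp: J_def)
  moreover have "degree E (v 2) = 1"
    using second[of 0] l by simp
  moreover have "v 1 \<noteq> v 2"
  proof
    assume "v 1 = v 2"
    moreover have "2 \<le> 1 + l * (k - 1)"
      using mult_le_mono[OF l, of 1 "k - 1"] k by simp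
    ultimately show False
      using inj_onD[OF bij_betw_imp_inj_on[OF bij], of 1 2] by simp
  qed
  ultimately show "\<exists>a b. a \<noteq> b \<and> degree E a = 1 \<and> degree E b = 1"
    by blast
qed

theorem theorem3p2:
  fixes E :: "'n::finite set set" and k :: nat
  assumes "3 \<le> k"
    and "k_uniform k E"
    and "sunflower k E \<or> hypercycle k E \<or> squid k E \<or> (\<exists>l. loose_path k l E)"
  shows "\<exists>j. min_degree_vertex E j \<and> alpha k E = alpha_at k E j"
proof -
  note main = alpha_eq_alpha_at_min_degree[OF _ assms(2)]
  have k: "2 \<le> k"
    using assms(1) by simp
  show ?thesis
    using assms(3)
  proof (elim disjE exE)
    assume "sunflower k E"
    from main[OF k sunflower_degree_1[OF assms(1) this]] show ?thesis .
  next
    assume "hypercycle k E"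
    from main[OF k hypercycle_degree_1[OF assms(1) this]] show ?thesis .
  next
    assume "squid k E"
    from main[OF k squid_degree_1[OF assms(1) this]] show ?thesis .
  next
    fix l assume "loose_path k l E"
    from main[OF k loose_path_degree_1[OF assms(1) this]] show ?thesis .
  qed
qed

end
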